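(* Fix the parameters $n,p_{\mathrm{gen}},p_{\mathrm{con}},\Gamma,F_{\mathrm{new}}$ and the policy coefficients $(a_k,b_k,c_k,d_k)_{k=1}^n$ of a 1G$n$B system. The availability $A$ is a non-increasing function of the purification probability $q\in[0,1]$, i.e. $$\frac{\partial A}{\partial q}\le0 .$$
   Context: Model (1G$n$B system). Parameters: an integer $n\ge1$; $p_{\mathrm{gen}}\in(0,1]$; $p_{\mathrm{con}}\in(0,1]$; $q\in[0,1]$; $\Gamma\ge0$; $F_{\mathrm{new}}\in(1/4,1]$; and, for $k=1,\dots,n$, real constants $a_k,b_k,c_k,d_k$ (the purification policy). Put $p_k(F)=c_k(F-\frac14)+d_k$ (success probability) and $J_k(F)=\frac14+\frac{a_k(F-1/4)+b_k}{c_k(F-1/4)+d_k}$ (jump function). Physicality: for all $F\in[1/4,1]$, $0\le p_k(F)\le1$ and $0\le a_k(F-\frac14)+b_k\le\frac34p_k(F)$ (i.e. $J_k(F)\in[1/4,1]$ when $p_k(F)>0$). Dynamics. For $t=1,2,\dots$ let $X_t\sim\mathrm{Bernoulli}(p_{\mathrm{con}})$ (a consumption request arrives at time $t$), $K_t\sim\mathrm{Bin}(n,p_{\mathrm{gen}})$, $Q_t\sim\mathrm{Bernoulli}(q)$, $W_t\sim\mathrm{Unif}[0,1]$, all independent. $F(t)$ is the fidelity of the link in memory G at time $t$ ($F(t)=0$ means G is empty); $F(0)=F_{\mathrm{new}}$. Let $F^-(t)=e^{-\Gamma}(F(t-1)-\frac14)+\frac14$ if $F(t-1)>0$ and $F^-(t)=0$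 if $F(t-1)=0$. If $F(t-1)=0$, then $F(t)=F_{\mathrm{new}}$ if $K_t\ge1$ and $F(t)=0$ otherwise. If $F(t-1)>0$: when $X_t=1$, $F(t)=0$ (consumption); when $X_t=0$, $K_t\ge1$, $Q_t=1$, with $k=K_t$, $F(t)=J_k(F^-(t))$ if $W_t<p_k(F^-(t))$ and $F(t)=0$ otherwise; in all remaining cases $F(t)=F^-(t)$. The availability is $A=\lim_{m\to\infty}\frac1m\sum_{j=1}^m\mathbb 1\{F^-(T^{(j)}_{\mathrm{con}})>0\}$, where $T^{(j)}_{\mathrm{con}}$ is the $j$-th time with $X_t=1$. Convention. $A$ is almost surely equal to a deterministic function of the parameters, and $A$ denotes this function: $$A=\frac{E_{\mathrm{occ}}}{\frac1{p^*_{\mathrm{gen}}}+E_{\mathrm{occ}}},\qquad E_{\mathrm{occ}}=\frac{1-\tilde A+\tilde C(F_{\mathrm{new}}-\frac14)}{[(1-\tilde A)(1-\tilde D)-\tilde B\tilde C]\tilde P},$$ where $p^*_{\mathrm{gen}}=1-(1-p_{\mathrm{gen}})^n$, $\tilde P=p_{\mathrm{con}}+qp^*_{\mathrm{gen}}(1-p_{\mathrm{con}})$, $\tilde A=\frac{q(1-p_{\mathrm{con}})\tilde a}{e^\Gamma-(1-qp^*_{\mathrm{gen}})(1-p_{\mathrm{con}})}$, $\tilde C=\frac{q(1-p_{\mathrm{con}})\tilde c}{e^\Gamma-(1-qp^*_{\mathrm{gen}})(1-p_{\mathrm{con}})}$, $\tilde B=\frac{q(1-p_{\mathrm{con}})\tilde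 b}{\tilde P}$, $\tilde D=\frac{q(1-p_{\mathrm{con}})\tilde d}{\tilde P}$, and $\tilde a=\sum_{k=1}^na_k\binom nk(1-p_{\mathrm{gen}})^{n-k}p_{\mathrm{gen}}^k$, with $\tilde b,\tilde c,\tilde d$ defined likewise from $b_k,c_k,d_k$. *)

theory Defs
  imports "HOL-Analysis.Analysis"
begin

text \<open>
  The 1GnB system: \<open>n\<close> bad memories, each producing a fresh link with probability \<open>p_gen\<close> per
  time step; consumption probability \<open>p_con\<close>; purification probability \<open>q\<close>; noise rate \<open>\<Gamma>\<close>;
  initial fidelity \<open>F_new\<close>. The purification policy is given by coefficients
  \<open>a k, b k, c k, d k\<close>, of which only those with \<open>1 \<le> k \<le> n\<close> are relevant. When \<open>k\<close> fresh links are
  used on a buffered link of fidelity \<open>F\<close>, purification succeeds with probability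
  \<open>c k * (F - 1/4) + d k\<close>, and on success the new fidelity is \<open>jump a b c d k F\<close>.
\<close>

definition success_prob :: "(nat \<Rightarrow> real) \<Rightarrow> (nat \<Rightarrow> real) \<Rightarrow> nat \<Rightarrow> real \<Rightarrow> real" where
  "success_prob c d k F = c k * (F - 1/4) + d k"

definition jump ::
  "(nat \<Rightarrow> real) \<Rightarrow> (nat \<Rightarrow> real) \<Rightarrow> (nat \<Rightarrow> real) \<Rightarrow> (nat \<Rightarrow> real) \<Rightarrow> nat \<Rightarrow> real \<Rightarrow> real" where
  "jump a b c d k F = 1/4 + (a k * (F - 1/4) + b k) / success_prob c d k F"

text \<open>
  The bounds on the numerator of the jump function are stated without division, so that they also
  apply where the success probability vanishes.
\<close>

definition physical_policy ::
  "nat \<Rightarrow> (nat \<Rightarrow> real) \<Rightarrow> (nat \<Rightarrow> real) \<Rightarrow> (nat \<Rightarrow> real) \<Rightarrow> (nat \<Rightarrow> real) \<Rightarrow> bool" where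
  "physical_policy n a b c d \<longleftrightarrow>
     (\<forall>k\<in>{1..n}. \<forall>F\<in>{1/4..1}.
        0 \<le> success_prob c d k F \<and> success_prob c d k F \<le> 1 \<and>
        0 \<le> a k * (F - 1/4) + b k \<and> a k * (F - 1/4) + b k \<le> 3/4 * success_prob c d k F)"

lemma physical_policy_jump_range:
  assumes "physical_policy n a b c d" "k \<in> {1..n}" "F \<in> {1/4..1}" "success_prob c d k F > 0"
  shows "jump a b c d k F \<in> {1/4..1}"
proof -
  let ?x = "a k * (F - 1/4) + b k" and ?p = "success_prob c d k F"
  have "0 \<le> ?x" "?x \<le> 3/4 * ?p"
    using assms unfolding physical_policy_def by blast+
  then have "0 \<le> ?x / ?p" "?x / ?p \<le> 3/4"
    using assms(4) by (simp_all add: pos_divide_le_eq)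
  then show ?thesis
    unfolding jump_def atLeastAtMost_iff by linarith
qed

definition p_gen_star :: "nat \<Rightarrow> real \<Rightarrow> real" where
  "p_gen_star n p_gen = 1 - (1 - p_gen) ^ n"

definition binomial_avg :: "nat \<Rightarrow> real \<Rightarrow> (nat \<Rightarrow> real) \<Rightarrow> real" where
  "binomial_avg n p_gen u =
     (\<Sum>k=1..n. u k * real (n choose k) * (1 - p_gen) ^ (n - k) * p_gen ^ k)"

definition P_tilde :: "nat \<Rightarrow> real \<Rightarrow> real \<Rightarrow> real \<Rightarrow> real" where
  "P_tilde n p_gen p_con q = p_con + q * p_gen_star n p_gen * (1 - p_con)"

text \<open>
  \<open>coeff_decay\<close> yields \<open>A_tilde\<close> and \<open>C_tilde\<close> (from \<open>a\<close> and \<open>c\<close>), and \<open>coeff_const\<close> yields \<open>B_tilde\<close> and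
  \<open>D_tilde\<close> (from \<open>b\<close> and \<open>d\<close>). Both denominators are positive for all admissible parameters.
\<close>

definition coeff_decay :: "nat \<Rightarrow> real \<Rightarrow> real \<Rightarrow> real \<Rightarrow> (nat \<Rightarrow> real) \<Rightarrow> real \<Rightarrow> real" where
  "coeff_decay n p_gen p_con \<Gamma> u q =
     q * (1 - p_con) * binomial_avg n p_gen u
       / (exp \<Gamma> - (1 - q * p_gen_star n p_gen) * (1 - p_con))"

definition coeff_const :: "nat \<Rightarrow> real \<Rightarrow> real \<Rightarrow> (nat \<Rightarrow> real) \<Rightarrow> real \<Rightarrow> real" where
  "coeff_const n p_gen p_con u q =
     q * (1 - p_con) * binomial_avg n p_gen u / P_tilde n p_gen p_con q"

text \<open>\<open>E_occ\<close> is the expected time for which the good memory stays occupied.\<close>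

definition E_occ ::
  "nat \<Rightarrow> real \<Rightarrow> real \<Rightarrow> real \<Rightarrow> real \<Rightarrow>
   (nat \<Rightarrow> real) \<Rightarrow> (nat \<Rightarrow> real) \<Rightarrow> (nat \<Rightarrow> real) \<Rightarrow> (nat \<Rightarrow> real) \<Rightarrow> real \<Rightarrow> real" where
  "E_occ n p_gen p_con \<Gamma> F_new a b c d q =
     (let A = coeff_decay n p_gen p_con \<Gamma> a q;
          B = coeff_const n p_gen p_con b q;
          C = coeff_decay n p_gen p_con \<Gamma> c q;
          D = coeff_const n p_gen p_con d q
      in (1 - A + C * (F_new - 1/4))
           / (((1 - A) * (1 - D) - B * C) * P_tilde n p_gen p_con q))"

text \<open>
  The availability, i.e. the almost sure long-run fraction of consumption requests that find a link
  in the good memory, as the explicit function of the parameters.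
\<close>

definition availability ::
  "nat \<Rightarrow> real \<Rightarrow> real \<Rightarrow> real \<Rightarrow> real \<Rightarrow>
   (nat \<Rightarrow> real) \<Rightarrow> (nat \<Rightarrow> real) \<Rightarrow> (nat \<Rightarrow> real) \<Rightarrow> (nat \<Rightarrow> real) \<Rightarrow> real \<Rightarrow> real" where
  "availability n p_gen p_con \<Gamma> F_new a b c d q =
     E_occ n p_gen p_con \<Gamma> F_new a b c d q
       / (1 / p_gen_star n p_gen + E_occ n p_gen p_con \<Gamma> F_new a b c d q)"

end

theory Submission
  imports Defs
begin

text \<open>
  Put \<open>s = q * (1 - p_con)\<close> and \<open>e = p_con + exp \<Gamma> - 1\<close>, and write \<open>a, b, c, d\<close> for the binomial
  averages of the policy and \<open>g\<close> for \<open>p_gen_star\<close>. Clearing denominators gives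
  \<open>E_occ = N / L\<close>, where \<open>N = e + s * (g - a + c * h)\<close> with \<open>h = F_new - 1/4\<close>, and \<open>L\<close> is the quadratic
  \<open>(e + s * (g - a)) * (p_con + s * (g - d)) - s\<^sup>2 * b * c\<close>. With \<open>w = (g - a) * (g - d) - b * c\<close>,
  \<open>N' * L - N * L' = e * (c * h * p_con - e * (g - d)) - 2 * s * e * w - s\<^sup>2 * (g - a + c * h) * w\<close>.
  Averaging the physicality bounds at \<open>F = 1/4\<close> and \<open>F = 1\<close> shows that \<open>w\<close>, \<open>g - a + c * h\<close> and
  \<open>g - d - c * h\<close> are nonnegative, so every term is nonpositive; and the availability increases
  with \<open>E_occ\<close>.
\<close>

lemma binomial_avg_affine:
  "binomial_avg n p (\<lambda>k. x * u k + v k) = x * binomial_avg n p u + binomial_avg n p v"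
  by (simp add: binomial_avg_def sum_distrib_left sum.distrib algebra_simps)

lemma binomial_avg_mono:
  assumes "0 \<le> p" "p \<le> 1" "\<And>k. k \<in> {1..n} \<Longrightarrow> u k \<le> v k"
  shows "binomial_avg n p u \<le> binomial_avg n p v"
  unfolding binomial_avg_def using assms by (intro sum_mono mult_right_mono) auto

text \<open>The binomial weights sum to 1 over \<open>0..n\<close>, and \<open>binomial_avg\<close>
  omits only the \<open>k = 0\<close> term \<open>(1 - p) ^ n\<close>.\<close>

lemma binomial_avg_one: "binomial_avg n p (\<lambda>k. 1) = p_gen_star n p"
proof -
  have "1 = (p + (1 - p)) ^ n" by simp
  also have "\<dots> = (\<Sum>k\<le>n. real (n choose k) * p ^ k * (1 - p) ^ (n - k))"
    by (rule binomial_ring)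
  also have "\<dots> = (1 - p) ^ n + (\<Sum>k=1..n. real (n choose k) * p ^ k * (1 - p) ^ (n - k))"
    by (simp add: atMost_atLeast0 sum.atLeast_Suc_atMost)
  finally show ?thesis
    by (simp add: binomial_avg_def p_gen_star_def mult_ac)
qed

lemma p_gen_star_pos:
  assumes "n \<ge> 1" "0 < p" "p \<le> 1"
  shows "0 < p_gen_star n p"
  using assms power_less_one_iff[of "1 - p" n] by (auto simp: p_gen_star_def)

text \<open>With \<open>x = F - 1/4\<close> fixed, the physicality bounds are linear in the
  coefficients, so averaging with nonnegative weights keeps them; the bound 1 becomes the total
  weight \<open>p_gen_star n p\<close>.\<close>

lemma physical_policy_binomial_avg:
  assumes "physical_policy n a b c d" "0 \<le> p" "p \<le> 1" "0 \<le> x" "x \<le> 3/4"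
  defines "avg \<equiv> binomial_avg n p"
  shows "x * avg c + avg d \<le> p_gen_star n p"
    and "0 \<le> x * avg a + avg b"
    and "x * avg a + avg b \<le> 3/4 * (x * avg c + avg d)"
proof -
  have phys: "x * c k + d k \<le> 1" "0 \<le> x * a k + b k"
    "x * a k + b k \<le> 3/4 * (x * c k + d k)" if "k \<in> {1..n}" for k
  proof -
    have "x + 1/4 \<in> {1/4..1}" using assms by simp
    with assms(1) that have "success_prob c d k (x + 1/4) \<le> 1"
      "0 \<le> a k * (x + 1/4 - 1/4) + b k"
      "a k * (x + 1/4 - 1/4) + b k \<le> 3/4 * success_prob c d k (x + 1/4)"
      unfolding physical_policy_def by blast+
    then show "x * c k + d k \<le> 1" "0 \<le> x * a k + b k"
      "x * a k + b k \<le> 3/4 * (x * c k + d k)"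
      by (simp_all add: success_prob_def mult.commute)
  qed
  show "x * avg c + avg d \<le> p_gen_star n p"
    using binomial_avg_mono[of p n "\<lambda>k. x * c k + d k" "\<lambda>k. 1"] assms(2,3) phys(1)
    by (simp add: avg_def binomial_avg_affine binomial_avg_one)
  have "binomial_avg n p (\<lambda>k. 0) = 0" by (simp add: binomial_avg_def)
  then show "0 \<le> x * avg a + avg b"
    using binomial_avg_mono[of p n "\<lambda>k. 0" "\<lambda>k. x * a k + b k"] assms(2,3) phys(2)
    by (simp add: avg_def binomial_avg_affine)
  have "binomial_avg n p (\<lambda>k. 3/4 * (x * c k + d k)) = 3/4 * (x * avg c + avg d)"
    using binomial_avg_affine[of n p "3/4" "\<lambda>k. x * c k + d k" "\<lambda>k. 0"]
      \<open>binomial_avg n p (\<lambda>k. 0) = 0\<close>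
    by (simp add: avg_def binomial_avg_affine)
  then show "x * avg a + avg b \<le> 3/4 * (x * avg c + avg d)"
    using binomial_avg_mono[of p n "\<lambda>k. x * a k + b k" "\<lambda>k. 3/4 * (x * c k + d k)"]
      assms(2,3) phys(3)
    by (simp add: avg_def binomial_avg_affine)
qed

text \<open>
  The last bound says that the determinant of \<open>g * I - M\<close> is nonnegative for the matrix \<open>M\<close> with rows
  \<open>(a, b)\<close> and \<open>(c, d)\<close>. For a physical policy, \<open>M\<close> preserves the cone spanned by \<open>(0, 1)\<close> and
  \<open>(3/4, 1)\<close> and increases the second coordinate by a factor of at most \<open>g\<close> there.
\<close>

lemma averaged_coefficient_bounds:
  fixes a b c d g h :: real
  assumes "0 \<le> b" "d \<le> g" "3/4 * c + d \<le> g"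
    and "3/4 * a + b \<le> 3/4 * (3/4 * c + d)" "0 \<le> h" "h \<le> 3/4"
  shows "0 \<le> g - a" "c * h \<le> g - d" "0 \<le> g - a + c * h" "0 \<le> (g - a) * (g - d) - b * c"
proof -
  have a: "a \<le> 3/4 * c + d - 4/3 * b" using assms(4) by argo
  then have u: "4/3 * b \<le> g - a" using assms(3) by linarith
  have v: "3/4 * c \<le> g - d" using assms(3) by linarith
  show u0: "0 \<le> g - a" using u assms by linarith
  show "c * h \<le> g - d"
  proof (cases "c \<ge> 0")
    case True
    then have "c * h \<le> c * (3/4)" using assms by (intro mult_left_mono) auto
    then show ?thesis using v by linarith
  next
    case False
    then have "c * h \<le> 0" using assms by (simp add: mult_nonpos_nonneg)
    then show ?thesis using assms by linarith
  qed
  show "0 \<le> g - a + c * h"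
  proof (cases "c \<ge> 0")
    case True
    then show ?thesis using u0 assms by simp
  next
    case False
    \<comment> \<open>For negative \<open>c\<close> the worst case is \<open>h = 3/4\<close>; there
      the bound on \<open>a\<close> cancels \<open>3/4 * c\<close> and leaves
      \<open>g - d + 4/3 * b\<close>.\<close>
    then have "c * (3/4) \<le> c * h" using assms by (intro mult_left_mono_neg) auto
    then show ?thesis using a assms(1,2) by linarith
  qed
  show "0 \<le> (g - a) * (g - d) - b * c"
  proof (cases "c \<ge> 0")
    case True
    then have "(4/3 * b) * (3/4 * c) \<le> (g - a) * (g - d)"
      using u v u0 assms by (intro mult_mono) auto
    then show ?thesis by simp
  next
    case False
    then have "b * c \<le> 0" using assms by (simp add: mult_nonneg_nonpos)
    moreover have "0 \<le> (g - a) * (g - d)" using u0 assms by simp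
    ultimately show ?thesis by linarith
  qed
qed

definition occ_num :: "real \<Rightarrow> real \<Rightarrow> real \<Rightarrow> real \<Rightarrow> real \<Rightarrow> real \<Rightarrow> real" where
  "occ_num e g a c h s = e + s * (g - a + c * h)"

definition occ_den ::
  "real \<Rightarrow> real \<Rightarrow> real \<Rightarrow> real \<Rightarrow> real \<Rightarrow> real \<Rightarrow> real \<Rightarrow> real \<Rightarrow> real" where
  "occ_den e p g a b c d s = (e + s * (g - a)) * (p + s * (g - d)) - s\<^sup>2 * b * c"

lemma occupation_ratio_derivative:
  fixes a b c d e g h p s :: real
  assumes bounds: "0 \<le> g - a" "0 \<le> g - d" "c * h \<le> g - d" "0 \<le> g - a + c * h"
      "0 \<le> (g - a) * (g - d) - b * c"
    and "0 < p" "p \<le> e" "0 < g" "0 \<le> s"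
  shows "0 < occ_num e g a c h s" "0 < occ_den e p g a b c d s"
    and "\<exists>D\<le>0. ((\<lambda>s. g * occ_num e g a c h s / (occ_den e p g a b c d s + g * occ_num e g a c h s))
                  has_real_derivative D) (at s)"
proof -
  define N where "N = occ_num e g a c h"
  define L where "L = occ_den e p g a b c d"
  define w where "w = (g - a) * (g - d) - b * c"
  have e: "0 < e" and w: "0 \<le> w" using assms by (auto simp: w_def)
  show N_pos: "0 < occ_num e g a c h s"
    using e assms unfolding occ_num_def by (intro add_pos_nonneg mult_nonneg_nonneg) auto
  \<comment> \<open>Sorted by powers of \<open>s\<close>, all coefficients are nonnegative and the
    constant term is positive.\<close>
  have "L s = e * p + s * (e * (g - d) + p * (g - a)) + s\<^sup>2 * w"
    by (simp add: L_def occ_den_def w_def algebra_simps power2_eq_square)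
  also have "\<dots> > 0"
    using e w assms by (intro add_pos_nonneg mult_nonneg_nonneg add_nonneg_nonneg) auto
  finally show L_pos: "0 < occ_den e p g a b c d s" by (simp add: L_def)
  define N' where "N' = g - a + c * h"
  define L' where "L' = (g - a) * (p + s * (g - d)) + (e + s * (g - a)) * (g - d) - 2 * s * b * c"
  have dN: "(N has_real_derivative N') (at s)"
    unfolding N_def occ_num_def[abs_def] N'_def by (auto intro!: derivative_eq_intros)
  have dL: "(L has_real_derivative L') (at s)"
    unfolding L_def occ_den_def[abs_def] L'_def by (auto intro!: derivative_eq_intros)
  have pos: "0 < L s + g * N s"
    using N_pos L_pos assms by (simp add: N_def L_def add_pos_pos)
  have "((\<lambda>s. g * N s / (L s + g * N s)) has_real_derivative
      (g * N' * (L s + g * N s) - g * N s * (L' + g * N')) / ((L s + g * N s) * (L s + g * N s))) (at s)"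
    using pos by (intro DERIV_divide DERIV_add DERIV_cmult dN dL) auto
  moreover have "(g * N' * (L s + g * N s) - g * N s * (L' + g * N')) / ((L s + g * N s) * (L s + g * N s)) \<le> 0"
  proof -
    \<comment> \<open>The value of \<open>N' * L - N * L'\<close> at \<open>s = 0\<close> is
      nonpositive because \<open>c * h \<le> g - d\<close> and \<open>p \<le> e\<close>.\<close>
    have "c * h * p \<le> (g - d) * p" using assms by (intro mult_right_mono) auto
    also have "\<dots> \<le> (g - d) * e" using assms by (intro mult_left_mono) auto
    finally have "e * (c * h * p - e * (g - d)) \<le> 0"
      using e by (simp add: mult_nonneg_nonpos mult.commute)
    moreover have "0 \<le> 2 * s * e * w" "0 \<le> s\<^sup>2 * (g - a + c * h) * w"
      using e w assms by auto
    moreover have "N' * L s - N s * L' =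
        e * (c * h * p - e * (g - d)) - 2 * s * e * w - s\<^sup>2 * (g - a + c * h) * w"
      unfolding N_def L_def occ_num_def occ_den_def N'_def L'_def w_def by algebra
    ultimately have "N' * L s - N s * L' \<le> 0" by linarith
    then have "g * (N' * L s - N s * L') \<le> 0"
      using assms by (simp add: mult_nonneg_nonpos)
    \<comment> \<open>The terms in \<open>N * N'\<close> cancel, so the ratio has the sign of the
      derivative of \<open>N / L\<close>.\<close>
    moreover have "g * N' * (L s + g * N s) - g * N s * (L' + g * N') = g * (N' * L s - N s * L')"
      by algebra
    ultimately show ?thesis by (simp add: divide_nonpos_nonneg)
  qed
  ultimately show "\<exists>D\<le>0. ((\<lambda>s. g * occ_num e g a c h s / (occ_den e p g a b c d s + g * occ_num e g a c h s))
                  has_real_derivative D) (at s)"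
    unfolding N_def L_def by blast
qed

text \<open>The trailing factor \<open>P\<close> absorbs the denominators of the \<open>b\<close>
  and \<open>d\<close> terms; then numerator and denominator share the factor \<open>1 / E\<close>,
  which cancels.\<close>

lemma clear_denominators:
  fixes E P a b c d h s :: real
  assumes "E \<noteq> 0" "P \<noteq> 0"
  shows "(1 - s * a / E + s * c / E * h) /
           (((1 - s * a / E) * (1 - s * d / P) - s * b / P * (s * c / E)) * P)
         = (E - s * a + s * c * h) / ((E - s * a) * (P - s * d) - s\<^sup>2 * b * c)"
proof -
  have "1 - s * a / E + s * c / E * h = (E - s * a + s * c * h) / E"
    using assms by (simp add: field_simps)
  moreover have "((1 - s * a / E) * (1 - s * d / P) - s * b / P * (s * c / E)) * P
      = ((E - s * a) * (P - s * d) - s\<^sup>2 * b * c) / E"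
    using assms by (simp add: field_simps power2_eq_square)
  ultimately show ?thesis using assms by simp
qed

text \<open>The choice of \<open>e\<close> and \<open>s\<close> turns the two denominators into
  \<open>e + s * g\<close> and \<open>p_con + s * g\<close>, both positive, so that \<open>q\<close>
  enters only through \<open>s\<close>.\<close>

lemma E_occ_eq:
  fixes n :: nat and p_gen p_con \<Gamma> F_new q :: real
  assumes "0 < p_con" "p_con \<le> 1" "\<Gamma> \<ge> 0" "0 \<le> q" "0 \<le> p_gen_star n p_gen"
  defines "avg \<equiv> binomial_avg n p_gen"
    and "g \<equiv> p_gen_star n p_gen" and "e \<equiv> p_con + exp \<Gamma> - 1" and "s \<equiv> q * (1 - p_con)"
  shows "E_occ n p_gen p_con \<Gamma> F_new a b c d q =
    occ_num e g (avg a) (avg c) (F_new - 1/4) s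
      / occ_den e p_con g (avg a) (avg b) (avg c) (avg d) s"
proof -
  have P: "P_tilde n p_gen p_con q = p_con + s * g"
    by (simp add: P_tilde_def s_def g_def mult_ac)
  have E: "exp \<Gamma> - (1 - q * p_gen_star n p_gen) * (1 - p_con) = e + s * g"
    by (simp add: e_def s_def g_def algebra_simps)
  have "0 \<le> s * g" using assms by simp
  moreover have "1 \<le> exp \<Gamma>" using assms by simp
  ultimately have nz: "p_con + s * g \<noteq> 0" "e + s * g \<noteq> 0"
    using assms(1) unfolding e_def by linarith+
  have eq: "E_occ n p_gen p_con \<Gamma> F_new a b c d q =
    (e + s * g - s * avg a + s * avg c * (F_new - 1/4)) /
      ((e + s * g - s * avg a) * (p_con + s * g - s * avg d) - s\<^sup>2 * avg b * avg c)"
    unfolding E_occ_def coeff_decay_def coeff_const_def Let_def P E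
      s_def[symmetric] avg_def[symmetric] using nz(2,1) by (rule clear_denominators)
  show ?thesis
    unfolding eq occ_num_def occ_den_def by (simp add: algebra_simps)
qed

theorem proposition1:
  fixes n :: nat and p_gen p_con \<Gamma> F_new :: real and a b c d :: "nat \<Rightarrow> real"
  assumes "n \<ge> 1"
    and "0 < p_gen" "p_gen \<le> 1"
    and "0 < p_con" "p_con \<le> 1"
    and "\<Gamma> \<ge> 0"
    and "1/4 < F_new" "F_new \<le> 1"
    and "physical_policy n a b c d"
  shows "antimono_on {0..1} (availability n p_gen p_con \<Gamma> F_new a b c d) \<and>
         (\<forall>q\<in>{0..1}. \<exists>A'. (availability n p_gen p_con \<Gamma> F_new a b c d has_real_derivative A')
                              (at q within {0..1}) \<and> A' \<le> 0)"
proof -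
  define avg where "avg = binomial_avg n p_gen"
  define g where "g = p_gen_star n p_gen"
  define e where "e = p_con + exp \<Gamma> - 1"
  define h where "h = F_new - 1/4"
  define N where "N = occ_num e g (avg a) (avg c) h"
  define L where "L = occ_den e p_con g (avg a) (avg b) (avg c) (avg d)"
  define R where "R = (\<lambda>s. g * N s / (L s + g * N s))"
  have g: "0 < g" using assms p_gen_star_pos by (simp add: g_def)
  have "1 \<le> exp \<Gamma>" using assms by simp
  then have e: "p_con \<le> e" by (simp add: e_def)
  have policy: "x * avg c + avg d \<le> g" "0 \<le> x * avg a + avg b"
    "x * avg a + avg b \<le> 3/4 * (x * avg c + avg d)" if "0 \<le> x" "x \<le> 3/4" for x
    using physical_policy_binomial_avg[OF assms(9) _ assms(3) that] assms(2)
    by (simp_all add: avg_def g_def)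
  have d: "avg d \<le> g" and b: "0 \<le> avg b" using policy[of 0] by auto
  have h: "0 \<le> h" "h \<le> 3/4" using assms by (auto simp: h_def)
  \<comment> \<open>\<open>x = 0\<close> and \<open>x = 3/4\<close> are the extreme fidelities
    \<open>F = 1/4\<close> and \<open>F = 1\<close>.\<close>
  note bounds = averaged_coefficient_bounds[OF b d policy(1)[of "3/4"] policy(3)[of "3/4"] h]
  have ratio: "0 < N s" "0 < L s" "\<exists>D\<le>0. (R has_real_derivative D) (at s)" if "0 \<le> s" for s
    unfolding N_def L_def R_def
    using occupation_ratio_derivative[of g "avg a" "avg d" "avg c" h "avg b" p_con e s]
      bounds d g e that assms(4) by simp_all
  have avail: "availability n p_gen p_con \<Gamma> F_new a b c d q = R (q * (1 - p_con))"
    if "q \<in> {0..1}" for q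
  proof -
    have s: "0 \<le> q * (1 - p_con)" using that assms by simp
    have "E_occ n p_gen p_con \<Gamma> F_new a b c d q = N (q * (1 - p_con)) / L (q * (1 - p_con))"
      unfolding N_def L_def h_def avg_def g_def e_def
      using assms that g by (intro E_occ_eq) (auto simp: g_def)
    moreover have "y / x / (1 / g + y / x) = g * y / (x + g * y)" if "0 < x" for x y
      using that g by (cases "x + g * y = 0") (simp_all add: field_simps)
    ultimately show ?thesis
      using ratio(2)[OF s] by (simp add: availability_def R_def g_def)
  qed
  have "antimono_on {0..1} (availability n p_gen p_con \<Gamma> F_new a b c d)"
  proof (rule monotone_onI)
    fix q q' :: real
    assume q: "q \<in> {0..1}" "q' \<in> {0..1}" "q \<le> q'"
    have "R (q' * (1 - p_con)) \<le> R (q * (1 - p_con))"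
    \<comment> \<open>\<open>R\<close> has a two-sided derivative at every \<open>s \<ge> 0\<close>,
      including \<open>s = 0\<close>, so the endpoints need no separate treatment.\<close>
    proof (rule DERIV_nonpos_imp_nonincreasing[where f = R])
      show "q * (1 - p_con) \<le> q' * (1 - p_con)"
        using q assms by (intro mult_right_mono) auto
    next
      fix s assume "q * (1 - p_con) \<le> s"
      moreover have "0 \<le> q * (1 - p_con)" using q assms by simp
      ultimately show "\<exists>D. (R has_real_derivative D) (at s) \<and> D \<le> 0"
        using ratio(3)[of s] by auto
    qed
    then show "availability n p_gen p_con \<Gamma> F_new a b c d q'
        \<le> availability n p_gen p_con \<Gamma> F_new a b c d q"
      using q avail by simp
  qed
  moreover have "\<exists>A'. (availability n p_gen p_con \<Gamma> F_new a b c d has_real_derivative A')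
      (at q within {0..1}) \<and> A' \<le> 0" if q: "q \<in> {0..1}" for q
  proof -
    have "0 \<le> q * (1 - p_con)" using q assms by simp
    then obtain D where D: "D \<le> 0" "(R has_real_derivative D) (at (q * (1 - p_con)))"
      using ratio(3) by blast
    have "((\<lambda>q. q * (1 - p_con)) has_real_derivative (1 - p_con)) (at q within {0..1})"
      by (auto intro!: derivative_eq_intros)
    then have "((\<lambda>q. R (q * (1 - p_con))) has_real_derivative D * (1 - p_con)) (at q within {0..1})"
      by (intro DERIV_chain2[where f = R and g = "\<lambda>q. q * (1 - p_con)"] D(2))
    then have "(availability n p_gen p_con \<Gamma> F_new a b c d has_real_derivative D * (1 - p_con))
        (at q within {0..1})"
      \<comment> \<open>The formula \<open>avail\<close> is known only on \<open>{0..1}\<close>,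
        which suffices for the derivative within that set; the radius 1 is arbitrary.\<close>
      by (rule has_field_derivative_transform_within[OF _ zero_less_one q]) (simp add: avail)
    moreover have "D * (1 - p_con) \<le> 0"
      using D(1) assms by (simp add: mult_nonpos_nonneg)
    ultimately show ?thesis by blast
  qed
  ultimately show ?thesis by blast
qed

end
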